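(* For every $n\ge 3$, the cycle graph $C_n$ is $132$-representable.
   Context: All graphs are finite and simple, and vertex labels are taken from a totally ordered set. The cycle graph $C_n$ ($n\ge 3$) is the graph on $n$ vertices that consists of a single cycle. For a finite word $w$, $A(w)$ is the set of letters occurring in $w$. Two distinct letters $x,y\in A(w)$ alternate in $w$ if deleting from $w$ all letters other than $x$ and $y$ leaves a word of the form $xyxy\cdots$ or $yxyx\cdots$ (of even or odd length). A word $w$ represents a graph $G=(V,E)$ if $A(w)=V$ and, for all $x\ne y$ in $V$, $x$ and $y$ alternate in $w$ if and only if $xy\in E$. A word $w=w_1\cdots w_m$ avoids the pattern $132$ (is $132$-avoiding) if there are no indices $i_1<i_2<i_3$ with $w_{i_1}<w_{i_3}<w_{i_2}$. A graph $G$ is $132$-representable if, possibly after relabelling its vertices by elements of a totally ordered set, there is a $132$-avoiding word that represents $G$. *)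

theory Defs
  imports Main
begin

text \<open>A graph is a pair \<open>(V, E)\<close> of a vertex set and a set of edges; the edge \<open>xy\<close> is the
  two-element set \<open>{x, y}\<close>.\<close>

type_synonym 'a graph = "'a set \<times> 'a set set"

definition finite_simple_graph :: "'a graph \<Rightarrow> bool" where
  "finite_simple_graph G \<longleftrightarrow> (case G of (V, E) \<Rightarrow>
     finite V \<and> (\<forall>e\<in>E. e \<subseteq> V \<and> card e = 2))"

definition relabel :: "('a \<Rightarrow> 'b) \<Rightarrow> 'a graph \<Rightarrow> 'b graph" where
  "relabel f G = (case G of (V, E) \<Rightarrow> (f ` V, (\<lambda>e. f ` e) ` E))"

text \<open>Meaningful for \<open>n \<ge> 3\<close> only; for \<open>n = 1\<close> the formula yields a loop and for \<open>n = 2\<close> a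
  single edge.\<close>

definition cycle_graph :: "nat \<Rightarrow> nat graph" where
  "cycle_graph n = ({0..<n}, (\<lambda>i. {i, (i + 1) mod n}) ` {0..<n})"

text \<open>The word \<open>xyxy\<dots>\<close> of length \<open>m\<close>.\<close>

definition alternating_word :: "'a \<Rightarrow> 'a \<Rightarrow> nat \<Rightarrow> 'a list" where
  "alternating_word x y m = map (\<lambda>i. if even i then x else y) [0..<m]"

definition alternate_in :: "'a list \<Rightarrow> 'a \<Rightarrow> 'a \<Rightarrow> bool" where
  "alternate_in w x y \<longleftrightarrow>
     (\<exists>m. filter (\<lambda>z. z = x \<or> z = y) w = alternating_word x y m \<or>
          filter (\<lambda>z. z = x \<or> z = y) w = alternating_word y x m)"

definition represents :: "'a list \<Rightarrow> 'a graph \<Rightarrow> bool" where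
  "represents w G \<longleftrightarrow> (case G of (V, E) \<Rightarrow>
     set w = V \<and> (\<forall>x\<in>V. \<forall>y\<in>V. x \<noteq> y \<longrightarrow> (alternate_in w x y \<longleftrightarrow> {x, y} \<in> E)))"

definition avoids_132 :: "'a::linorder list \<Rightarrow> bool" where
  "avoids_132 w \<longleftrightarrow>
     \<not> (\<exists>i j k. i < j \<and> j < k \<and> k < length w \<and> w ! i < w ! k \<and> w ! k < w ! j)"

text \<open>Labels are taken from \<open>nat\<close>. As words are finite, this covers labels from an arbitrary
  totally ordered set: see \<open>representable_132_any_linorder\<close> below.\<close>

definition representable_132 :: "'a graph \<Rightarrow> bool" where
  "representable_132 G \<longleftrightarrow>
     (\<exists>(f :: 'a \<Rightarrow> nat) w. inj_on f (fst G) \<and> represents w (relabel f G) \<and> avoids_132 w)"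

lemma finite_simple_graph_cycle_graph:
  assumes "n \<ge> 3"
  shows "finite_simple_graph (cycle_graph n)"
proof -
  have "i \<noteq> Suc i mod n" if "i < n" for i
    using that assms by (cases "Suc i = n") auto
  then show ?thesis
    using assms by (auto simp: finite_simple_graph_def cycle_graph_def card_insert_if)
qed

lemma alternate_in_map:
  assumes "inj_on g (set w)" "x \<in> set w" "y \<in> set w"
  shows "alternate_in (map g w) (g x) (g y) \<longleftrightarrow> alternate_in w x y"
proof -
  have flt: "filter (\<lambda>z. z = g x \<or> z = g y) (map g w) = map g (filter (\<lambda>z. z = x \<or> z = y) w)"
    using assms by (auto simp: filter_map o_def inj_on_eq_iff intro!: arg_cong[where f="map g"] filter_cong)
  have alt: "alternating_word (g a) (g b) m = map g (alternating_word a b m)" for a b m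
    by (auto simp: alternating_word_def)
  have inj: "map g (filter (\<lambda>z. z = x \<or> z = y) w) = map g (alternating_word a b m) \<longleftrightarrow>
      filter (\<lambda>z. z = x \<or> z = y) w = alternating_word a b m"
    if "a \<in> set w" "b \<in> set w" for a b m
    using that assms(1)
    by (intro inj_on_map_eq_map) (auto simp: alternating_word_def inj_on_def split: if_splits)
  show ?thesis
    unfolding alternate_in_def flt alt using inj assms by simp
qed

lemma representable_132_any_linorder:
  fixes f :: "'a \<Rightarrow> 'b::linorder"
  assumes simple: "finite_simple_graph G" and f: "inj_on f (fst G)"
    and w: "represents w (relabel f G)" and av: "avoids_132 w"
  shows "representable_132 G"
proof -
  obtain V E where G: "G = (V, E)" by (cases G)
  define g where "g b = card {c \<in> set w. c < b}" for b
  have less: "g a < g b" if "a \<in> set w" "a < b" for a b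
    unfolding g_def using that by (intro psubset_card_mono) auto
  have iff: "g a < g b \<longleftrightarrow> a < b" if "a \<in> set w" "b \<in> set w" for a b
    using less that by (metis less_asym less_irrefl neqE)
  have inj: "inj_on g (set w)"
    using iff by (metis inj_onI less_irrefl neqE)
  have V: "set w = f ` V" using w G by (simp add: represents_def relabel_def)
  have "inj_on (g \<circ> f) V" using f inj V G by (simp add: comp_inj_on)
  moreover have "represents (map g w) (relabel (g \<circ> f) G)"
    unfolding represents_def relabel_def G split
  proof (intro conjI ballI impI)
    show "set (map g w) = (g \<circ> f) ` V" using V by auto
    fix x y assume "x \<in> (g \<circ> f) ` V" "y \<in> (g \<circ> f) ` V" "x \<noteq> y"
    then obtain a b where ab: "a \<in> V" "b \<in> V" "x = g (f a)" "y = g (f b)" "f a \<noteq> f b"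
      by (metis (no_types, lifting) comp_apply imageE)
    have fV: "f a \<in> set w" "f b \<in> set w" using ab V by auto
    have sub: "e \<subseteq> V" if "e \<in> E" for e
      using simple G that by (auto simp: finite_simple_graph_def)
    have "{f a, f b} \<in> (\<lambda>e. f ` e) ` E \<longleftrightarrow> {x, y} \<in> (\<lambda>e. (g \<circ> f) ` e) ` E"
    proof -
      have "{x, y} = (g \<circ> f) ` e \<longleftrightarrow> {f a, f b} = f ` e" if "e \<in> E" for e
      proof -
        have "f ` e \<subseteq> set w" "{f a, f b} \<subseteq> set w" using sub[OF that] V fV by auto
        then have "g ` {f a, f b} = g ` f ` e \<longleftrightarrow> {f a, f b} = f ` e"
          using inj by (metis inj_on_image_eq_iff)
        then show ?thesis using ab by (simp add: image_comp)
      qed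
      then show ?thesis by (auto simp: image_iff simp del: image_comp)
    qed
    moreover have "alternate_in (map g w) x y \<longleftrightarrow> alternate_in w (f a) (f b)"
      using alternate_in_map[OF inj fV] ab by simp
    moreover have "alternate_in w (f a) (f b) \<longleftrightarrow> {f a, f b} \<in> (\<lambda>e. f ` e) ` E"
      using w ab G by (auto simp: represents_def relabel_def)
    ultimately show "alternate_in (map g w) x y \<longleftrightarrow> {x, y} \<in> (\<lambda>e. (g \<circ> f) ` e) ` E"
      by simp
  qed
  moreover have "avoids_132 (map g w)"
    using av unfolding avoids_132_def by (auto simp: iff)
  ultimately show ?thesis
    unfolding representable_132_def G by auto
qed

end

theory Submission
  imports Defs
begin

text \<open>
  The vertices keep their labels \<open>0, \<dots>, n - 1\<close>. With \<open>k = n - 2\<close>, the representing word is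
  \<open>k + 1 | k - 1, k | k - 2, k - 1 | \<dots> | 1, 2 | 0, 1 | k + 1 | 0\<close>.
  The middle part consists of the blocks \<open>j, j + 1\<close> in decreasing order. Consecutive letters
  overlap there as \<open>\<dots> j + 1 \<dots> j, j + 1 \<dots> j \<dots>\<close> and so alternate, whereas all
  occurrences of a letter precede those of any letter smaller by two or more. Together with the
  final \<open>0\<close> this represents the path \<open>0, \<dots>, k\<close>. In the middle part \<open>k\<close> occurs only once, and
  so does \<open>0\<close>; the letters strictly between them occur twice. Hence the two copies of the new
  letter \<open>k + 1\<close> around the middle part alternate with \<open>k\<close> and with \<open>0\<close>, but with nothing else,
  and the path is closed to a cycle. The last \<open>0\<close> is there because \<open>0\<close> and \<open>k\<close>, if they both
  occurred only once in the whole word, would alternate.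

  The word avoids \<open>132\<close> because the letters exceeding a given letter \<open>a\<close> that come after it
  are at most \<open>a + 1\<close> followed by \<open>k + 1\<close>, in this order (\<open>avoids_132_staircase\<close>). For the
  alternation of two letters, their subsequence is computed explicitly
  (\<open>filter_pair_staircase\<close>) and tested for equal neighbours (\<open>alternate_in_iff_distinct_adj\<close>).
\<close>

lemma alternating_word_Suc: "alternating_word x y (Suc m) = x # alternating_word y x m"
  unfolding alternating_word_def map_upt_Suc by simp

lemma distinct_adj_alternating_word:
  "x \<noteq> y \<Longrightarrow> distinct_adj (alternating_word x y m)"
proof (induction m arbitrary: x y)
  case 0
  show ?case by (simp add: alternating_word_def)
next
  case (Suc m)
  then show ?case
    by (cases m) (auto simp: alternating_word_Suc distinct_adj_Cons_Cons alternating_word_def[of _ _ 0])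
qed

text \<open>A word over two letters is determined by its first letter once equal neighbours are
  excluded.\<close>

lemma distinct_adj_imp_alternating_word:
  assumes "distinct_adj (x # v)" "set v \<subseteq> {x, y}"
  shows "x # v = alternating_word x y (Suc (length v))"
  using assms
proof (induction v arbitrary: x y)
  case Nil
  show ?case by (simp add: alternating_word_def)
next
  case (Cons a v)
  then have "a = y" "distinct_adj (y # v)" "set v \<subseteq> {y, x}" by auto
  then show ?case using Cons.IH[of y x] by (simp add: alternating_word_Suc)
qed

lemma alternate_in_iff_distinct_adj:
  assumes "x \<noteq> y"
  shows "alternate_in w x y \<longleftrightarrow> distinct_adj (filter (\<lambda>z. z = x \<or> z = y) w)"
proof
  assume "alternate_in w x y"
  then show "distinct_adj (filter (\<lambda>z. z = x \<or> z = y) w)"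
    using assms distinct_adj_alternating_word unfolding alternate_in_def by metis
next
  let ?f = "filter (\<lambda>z. z = x \<or> z = y) w"
  assume adj: "distinct_adj ?f"
  show "alternate_in w x y"
  proof (cases ?f)
    case Nil
    then have "?f = alternating_word x y 0" by (simp add: alternating_word_def)
    then show ?thesis unfolding alternate_in_def by blast
  next
    case (Cons a v)
    have "set ?f \<subseteq> {x, y}" by auto
    then have "a = x \<or> a = y" "set v \<subseteq> {x, y}" "set v \<subseteq> {y, x}"
      unfolding Cons by auto
    then have "?f = alternating_word x y (Suc (length v)) \<or>
        ?f = alternating_word y x (Suc (length v))"
      using adj distinct_adj_imp_alternating_word unfolding Cons by metis
    then show ?thesis unfolding alternate_in_def by blast
  qed
qed

lemma alternate_in_commute: "alternate_in w x y \<longleftrightarrow> alternate_in w y x"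
  unfolding alternate_in_def by (metis (no_types, lifting) disj_commute filter_cong)

text \<open>The first letter \<open>a\<close> plays the role of 1 in a pattern 132 exactly if the later letters
  exceeding \<open>a\<close> contain a descent.\<close>

lemma avoids_132_Cons:
  "avoids_132 (a # w) \<longleftrightarrow> sorted (filter (\<lambda>z. a < z) w) \<and> avoids_132 w"
proof -
  have sorted_iff: "sorted (filter (\<lambda>z. a < z) w) \<longleftrightarrow>
      \<not> (\<exists>j k. j < k \<and> k < length w \<and> a < w ! k \<and> w ! k < w ! j)" for w :: "'a list"
  proof (induction w)
    case Nil
    show ?case by simp
  next
    case (Cons b w)
    have "(\<exists>j k. j < k \<and> k < length (b # w) \<and> a < (b # w) ! k \<and> (b # w) ! k < (b # w) ! j)
        \<longleftrightarrow> (\<exists>k<length w. a < w ! k \<and> w ! k < b) \<or>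
          (\<exists>j k. j < k \<and> k < length w \<and> a < w ! k \<and> w ! k < w ! j)"
      (is "?L \<longleftrightarrow> ?R")
    proof
      assume ?L
      then obtain j k where jk: "j < k" "k < length (b # w)"
        "a < (b # w) ! k" "(b # w) ! k < (b # w) ! j" by blast
      then obtain k' where "k = Suc k'" by (cases k) auto
      with jk show ?R by (cases j) auto
    next
      assume ?R
      then show ?L
      proof (elim disjE exE conjE)
        fix k assume "k < length w" "a < w ! k" "w ! k < b"
        then show ?L by (intro exI[of _ 0] exI[of _ "Suc k"]) auto
      next
        fix j k assume "j < k" "k < length w" "a < w ! k" "w ! k < w ! j"
        then show ?L by (intro exI[of _ "Suc j"] exI[of _ "Suc k"]) auto
      qed
    qed
    moreover have "(\<exists>k<length w. a < w ! k \<and> w ! k < b) \<longleftrightarrow> (\<exists>z\<in>set w. a < z \<and> z < b)"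
      by (metis in_set_conv_nth)
    ultimately show ?case
      using Cons.IH by (auto simp: not_less)
  qed
  have "avoids_132 (a # w) \<longleftrightarrow>
      \<not> (\<exists>j k. j < k \<and> k < length w \<and> a < w ! k \<and> w ! k < w ! j) \<and> avoids_132 w"
    (is "_ \<longleftrightarrow> \<not> ?D \<and> _")
  proof -
    have "\<not> avoids_132 (a # w) \<longleftrightarrow> ?D \<or> \<not> avoids_132 w"
    proof
      assume "\<not> avoids_132 (a # w)"
      then obtain i j k where ijk: "i < j" "j < k" "k < length (a # w)"
        "(a # w) ! i < (a # w) ! k" "(a # w) ! k < (a # w) ! j"
        unfolding avoids_132_def by blast
      then obtain j' k' where "j = Suc j'" "k = Suc k'" by (cases j; cases k) auto
      with ijk show "?D \<or> \<not> avoids_132 w"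
        unfolding avoids_132_def by (cases i) auto
    next
      assume "?D \<or> \<not> avoids_132 w"
      then show "\<not> avoids_132 (a # w)"
      proof
        assume ?D
        then obtain j k where "j < k" "k < length w" "a < w ! k" "w ! k < w ! j" by blast
        then show ?thesis unfolding avoids_132_def not_not
          by (intro exI[of _ 0] exI[of _ "Suc j"] exI[of _ "Suc k"]) auto
      next
        assume "\<not> avoids_132 w"
        then obtain i j k where "i < j" "j < k" "k < length w" "w ! i < w ! k" "w ! k < w ! j"
          unfolding avoids_132_def by blast
        then show ?thesis unfolding avoids_132_def not_not
          by (intro exI[of _ "Suc i"] exI[of _ "Suc j"] exI[of _ "Suc k"]) auto
      qed
    qed
    then show ?thesis by blast
  qed
  then show ?thesis using sorted_iff[of w] by blast
qed

fun staircase :: "nat \<Rightarrow> nat list" where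
  "staircase 0 = []"
| "staircase (Suc k) = k # Suc k # staircase k"

lemma set_staircase: "set (staircase k) = (if k = 0 then {} else {..k})"
  by (induction k) (auto split: if_splits)

lemma staircase_le: "z \<in> set (staircase k) \<Longrightarrow> z \<le> k"
  by (simp add: set_staircase split: if_splits)

text \<open>Behind the leading \<open>k\<close> of a staircase, the only letter of the remaining staircase that
  exceeds it is \<open>k + 1\<close>. An appended \<open>m > k\<close> is at least \<open>k + 1\<close> and so makes no descent with
  it.\<close>

lemma avoids_132_staircase: "avoids_132 (staircase k @ [m, 0])"
proof (induction k)
  case 0
  show ?case by (auto simp: avoids_132_Cons) (simp add: avoids_132_def)
next
  case (Suc k)
  have "filter (\<lambda>z. a < z) (staircase k) = []" if "k \<le> a" for a
    using that staircase_le by (fastforce simp: filter_empty_conv)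
  then show ?case using Suc by (simp add: avoids_132_Cons)
qed

lemma filter_single_staircase:
  "filter (\<lambda>z. z = x) (staircase k) =
     (if x < k then [x] else []) @ (if 0 < x \<and> x \<le> k then [x] else [])"
  by (induction k) auto

text \<open>Only for \<open>y = x + 1\<close> does the block \<open>x, y\<close> occur, and it puts an \<open>x\<close> before the last
  \<open>y\<close>.\<close>

lemma filter_pair_staircase:
  assumes "x < y" "y \<le> k"
  shows "filter (\<lambda>z. z = x \<or> z = y) (staircase k) =
     (if y < k then [y] else []) @ (if y = Suc x then [x, y] else [y, x]) @
     (if 0 < x then [x] else [])"
  using assms(2)
proof (induction k)
  case 0
  then show ?case using assms(1) by simp
next
  case (Suc k)
  show ?case
  proof (cases "y = Suc k")
    case True
    then have "filter (\<lambda>z. z = x \<or> z = y) (staircase k) = filter (\<lambda>z. z = x) (staircase k)"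
      using staircase_le by (fastforce intro!: filter_cong)
    then show ?thesis using True assms(1) by (auto simp: filter_single_staircase)
  next
    case False
    then have "y \<le> k" using Suc.prems by simp
    with Suc.IH show ?thesis using assms(1) by auto
  qed
qed

definition cycle_word :: "nat \<Rightarrow> nat list" where
  "cycle_word k = Suc k # staircase k @ [Suc k, 0]"

lemma set_cycle_word: "0 < k \<Longrightarrow> set (cycle_word k) = {..Suc k}"
  by (auto simp: cycle_word_def set_staircase)

lemma avoids_132_cycle_word: "avoids_132 (cycle_word k)"
proof -
  have "filter (\<lambda>z. Suc k < z) (staircase k) = []"
    using staircase_le by (fastforce simp: filter_empty_conv)
  then show ?thesis
    by (simp add: cycle_word_def avoids_132_Cons avoids_132_staircase)
qed

lemma alternate_in_cycle_word:
  assumes "0 < k" "x < y" "y \<le> Suc k"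
  shows "alternate_in (cycle_word k) x y \<longleftrightarrow> y = Suc x \<or> x = 0 \<and> y = Suc k"
proof -
  let ?f = "filter (\<lambda>z. z = x \<or> z = y) (cycle_word k)"
  have "distinct_adj ?f \<longleftrightarrow> y = Suc x \<or> x = 0 \<and> y = Suc k"
  proof (cases "y = Suc k")
    case True
    then have "filter (\<lambda>z. z = x \<or> z = y) (staircase k) = filter (\<lambda>z. z = x) (staircase k)"
      using staircase_le by (fastforce intro!: filter_cong)
    then have "?f = y # (if x < k then [x] else []) @ (if 0 < x then [x] else []) @
        y # (if x = 0 then [0] else [])"
      using True assms by (auto simp: cycle_word_def filter_single_staircase)
    then show ?thesis using True assms by (auto simp: distinct_adj_Cons_Cons)
  next
    case False
    \<comment> \<open>The \<open>0\<close> at the end of the word supplies the second occurrence that \<open>x = 0\<close> lacks in the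
      staircase, so both cases \<open>x = 0\<close> and \<open>x > 0\<close> look the same.\<close>
    then have "?f = (if y < k then [y] else []) @ (if y = Suc x then [x, y] else [y, x]) @ [x]"
      using assms by (auto simp: cycle_word_def filter_pair_staircase)
    then show ?thesis using False assms by (auto simp: distinct_adj_Cons_Cons)
  qed
  then show ?thesis using assms(2) by (simp add: alternate_in_iff_distinct_adj)
qed

lemma edge_cycle_graph_iff:
  assumes "3 \<le> n" "x < y" "y < n"
  shows "{x, y} \<in> snd (cycle_graph n) \<longleftrightarrow> y = Suc x \<or> x = 0 \<and> Suc y = n"
proof
  assume "{x, y} \<in> snd (cycle_graph n)"
  then obtain i where i: "i < n" "{x, y} = {i, Suc i mod n}"
    by (auto simp: cycle_graph_def)
  show "y = Suc x \<or> x = 0 \<and> Suc y = n"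
    using i assms by (cases "Suc i = n") (auto simp: doubleton_eq_iff)
next
  assume "y = Suc x \<or> x = 0 \<and> Suc y = n"
  then have "{x, y} = {x, Suc x mod n} \<or> {x, y} = {y, Suc y mod n}"
    using assms by auto
  moreover have "x < n" using assms by simp
  ultimately show "{x, y} \<in> snd (cycle_graph n)"
    using assms(3) by (auto simp: cycle_graph_def)
qed

lemma represents_cycle_word:
  assumes "3 \<le> n"
  shows "represents (cycle_word (n - 2)) (cycle_graph n)"
proof -
  have n: "0 < n - 2" "Suc (n - 2) = n - 1" using assms by auto
  have ordered: "alternate_in (cycle_word (n - 2)) x y \<longleftrightarrow> {x, y} \<in> snd (cycle_graph n)"
    if "x < y" "y < n" for x y
    using that assms n alternate_in_cycle_word[of "n - 2" x y] edge_cycle_graph_iff[of n x y]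
    by auto
  have "alternate_in (cycle_word (n - 2)) x y \<longleftrightarrow> {x, y} \<in> snd (cycle_graph n)"
    if "x \<noteq> y" "x < n" "y < n" for x y
    using ordered[of x y] ordered[of y x] that alternate_in_commute[of _ x y]
    by (metis insert_commute linorder_neqE_nat)
  moreover have "set (cycle_word (n - 2)) = {0..<n}"
    using n assms by (auto simp: set_cycle_word)
  ultimately show ?thesis by (simp add: represents_def cycle_graph_def)
qed

theorem corollary4p3:
  fixes n :: nat
  assumes "n \<ge> 3"
  shows "representable_132 (cycle_graph n)"
proof -
  have "relabel id (cycle_graph n) = cycle_graph n"
    by (simp add: relabel_def cycle_graph_def)
  then have "represents (cycle_word (n - 2)) (relabel id (cycle_graph n))"
    using represents_cycle_word[OF assms] by simp
  then show ?thesis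
    unfolding representable_132_def using avoids_132_cycle_word inj_on_id by blast
qed

end
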